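(* Let $G$ be a Hausdorff topological group and let $S\subseteq G$ be a subsemigroup of $G$ which is precompact in $G$. Then the closure $\overline{S}$ of $S$ in $G$ is a precompact subgroup of $G$.
   Context: A subsemigroup of a group $G$ is a nonempty subset $S\subseteq G$ with $SS\subseteq S$. A subset $A$ of a topological group $G$ with neutral element $e$ is precompact in $G$ if for every neighborhood $V$ of $e$ there exists a finite set $K\subseteq G$ such that $A\subseteq KV$ and $A\subseteq VK$. *)

theory Defs
  imports "HOL-Analysis.Abstract_Topological_Spaces" "HOL-Algebra.Coset"
begin

locale topological_group = group G for G :: "('a, 'b) monoid_scheme" (structure) +
  fixes T :: "'a topology"
  assumes topspace_eq_carrier: "topspace T = carrier G"
    and continuous_mult:
      "continuous_map (prod_topology T T) T (\<lambda>(x, y). x \<otimes> y)"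
    and continuous_inv: "continuous_map T T (\<lambda>x. inv x)"

definition subsemigroup :: "'a set \<Rightarrow> ('a, 'b) monoid_scheme \<Rightarrow> bool" where
  "subsemigroup S G \<longleftrightarrow>
     S \<noteq> {} \<and> S \<subseteq> carrier G \<and> S <#>\<^bsub>G\<^esub> S \<subseteq> S"

text \<open>Neighbourhoods need not be open.\<close>

definition neighbourhood_in :: "'a topology \<Rightarrow> 'a \<Rightarrow> 'a set \<Rightarrow> bool" where
  "neighbourhood_in T x V \<longleftrightarrow>
     V \<subseteq> topspace T \<and> (\<exists>U. openin T U \<and> x \<in> U \<and> U \<subseteq> V)"

definition precompact_in ::
    "('a, 'b) monoid_scheme \<Rightarrow> 'a topology \<Rightarrow> 'a set \<Rightarrow> bool" where
  "precompact_in G T A \<longleftrightarrow>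
     A \<subseteq> carrier G \<and>
     (\<forall>V. neighbourhood_in T \<one>\<^bsub>G\<^esub> V \<longrightarrow>
        (\<exists>K. finite K \<and> K \<subseteq> carrier G \<and>
             A \<subseteq> K <#>\<^bsub>G\<^esub> V \<and> A \<subseteq> V <#>\<^bsub>G\<^esub> K))"

end

theory Submission
  imports Defs
begin

text \<open>Among the powers of \<open>s \<in> S\<close>, precompactness and the pigeonhole principle yield \<open>n\<close> and
  \<open>p \<ge> 1\<close> with \<open>s\<^sup>n\<close> and \<open>s\<^sup>n\<^sup>+\<^sup>p\<^sup>+\<^sup>1\<close> in a common translate of a small neighbourhood of the
  neutral element, so \<open>s\<^sup>p \<in> S\<close> is close to the inverse of \<open>s\<close>. Hence the inverse lies in
  the closure of \<open>S\<close>.\<close>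

context topological_group
begin

lemma continuous_map_mult:
  assumes "continuous_map X T f" and "continuous_map X T g"
  shows "continuous_map X T (\<lambda>x. f x \<otimes> g x)"
  using continuous_map_compose[OF continuous_map_pairedI[OF assms] continuous_mult]
  by (simp add: o_def)

lemma continuous_map_inv:
  assumes "continuous_map X T f"
  shows "continuous_map X T (\<lambda>x. inv (f x))"
  using continuous_map_compose[OF assms continuous_inv] by (simp add: o_def)

text \<open>The preimage of \<open>U\<close> contains an open box \<open>A \<times> B\<close> around
  \<open>(\<one>, \<one>)\<close>; intersecting its sides lets both variables range over one
  neighbourhood. This supplies every small neighbourhood chosen below.\<close>

lemma continuous_map_at_one_pair:
  assumes f: "continuous_map (prod_topology T T) T f"
    and U: "openin T U" "f (\<one>, \<one>) \<in> U"
  obtains N where "openin T N" "\<one> \<in> N" "\<And>a b. a \<in> N \<Longrightarrow> b \<in> N \<Longrightarrow> f (a, b) \<in> U"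
proof -
  have "openin (prod_topology T T) {z \<in> topspace (prod_topology T T). f z \<in> U}"
    using openin_continuous_map_preimage[OF f U(1)] .
  moreover have "(\<one>, \<one>) \<in> {z \<in> topspace (prod_topology T T). f z \<in> U}"
    using U(2) by (simp add: topspace_eq_carrier)
  ultimately obtain A B where "openin T A" "openin T B" "\<one> \<in> A" "\<one> \<in> B"
    and AB: "A \<times> B \<subseteq> {z \<in> topspace (prod_topology T T). f z \<in> U}"
    unfolding openin_prod_topology_alt by meson
  then show thesis
    by (intro that[of "A \<inter> B"]) auto
qed

text \<open>The closure of \<open>S \<times> S\<close> is the product of the closures, and the
  jointly continuous multiplication maps it into the closure of the image of
  \<open>S \<times> S\<close>, which lies in \<open>S\<close>.\<close>

lemma closure_of_mult_closed:
  assumes S: "S <#> S \<subseteq> S" and xy: "x \<in> T closure_of S" "y \<in> T closure_of S"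
  shows "x \<otimes> y \<in> T closure_of S"
proof -
  have "(\<lambda>(x, y). x \<otimes> y) ` (S \<times> S) \<subseteq> S"
    using S by (auto simp: set_mult_def)
  then have "(\<lambda>(x, y). x \<otimes> y) ` ((T closure_of S) \<times> (T closure_of S)) \<subseteq> T closure_of S"
    using continuous_map_image_closure_subset[OF continuous_mult, of "S \<times> S"] closure_of_mono
    unfolding closure_of_Times by (metis subset_trans)
  with xy show ?thesis by auto
qed

lemma inv_in_closure_of_precompact_subsemigroup:
  assumes S: "subsemigroup S G" and pre: "precompact_in G T S" and s: "s \<in> S"
  shows "inv s \<in> T closure_of S"
proof -
  have sub: "S \<subseteq> carrier G" and mult: "S <#> S \<subseteq> S"
    using S by (auto simp: subsemigroup_def)
  have sc [simp]: "s \<in> carrier G" using s sub by auto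
  \<comment> \<open>Only positive exponents are used, since \<open>\<one>\<close> need not lie in
    \<open>S\<close>.\<close>
  have pow: "s [^] Suc n \<in> S" for n :: nat
  proof (induction n)
    case (Suc n)
    then have "s [^] Suc n \<otimes> s \<in> S <#> S" using s by (auto simp: set_mult_def)
    then show ?case using mult by auto
  qed (use s in simp)
  have "\<exists>y \<in> S. y \<in> U" if U: "openin T U" "inv s \<in> U" for U
  proof -
    \<comment> \<open>This map sends \<open>(\<one>, \<one>)\<close> to \<open>inv s\<close>, so
      some \<open>N\<close> satisfies \<open>inv s \<otimes> (inv a \<otimes> b) \<in> U\<close> for
      all \<open>a\<close>, \<open>b\<close> in \<open>N\<close>.\<close>
    have "continuous_map (prod_topology T T) T (\<lambda>z. inv s \<otimes> (inv (fst z) \<otimes> snd z))"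
      by (intro continuous_map_mult continuous_map_inv continuous_map_fst continuous_map_snd)
        (simp add: topspace_eq_carrier)
    then obtain N where N: "openin T N" "\<one> \<in> N"
      and NU: "\<And>a b. a \<in> N \<Longrightarrow> b \<in> N \<Longrightarrow> inv s \<otimes> (inv a \<otimes> b) \<in> U"
      using continuous_map_at_one_pair[of "\<lambda>z. inv s \<otimes> (inv (fst z) \<otimes> snd z)" U] U by auto
    have Nc: "N \<subseteq> carrier G" using N(1) openin_subset topspace_eq_carrier by blast
    have "neighbourhood_in T \<one> N"
      using N Nc by (auto simp: neighbourhood_in_def topspace_eq_carrier)
    with pre obtain K where K: "finite K" "K \<subseteq> carrier G" "S \<subseteq> K <#> N"
      unfolding precompact_in_def by blast
    have "\<forall>n::nat. \<exists>k \<in> K. \<exists>a \<in> N. s [^] Suc n = k \<otimes> a"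
      using pow K(3) unfolding set_mult_def by blast
    then have "\<exists>k \<in> K. infinite {n::nat. \<exists>a \<in> N. s [^] Suc n = k \<otimes> a}"
      using pigeonhole_infinite_rel[of UNIV K "\<lambda>n k. \<exists>a \<in> N. s [^] Suc n = k \<otimes> a"] K(1)
      by simp
    then obtain k where k: "k \<in> K" and inf: "infinite {n::nat. \<exists>a \<in> N. s [^] Suc n = k \<otimes> a}" ..
    obtain n where "n \<in> {n::nat. \<exists>a \<in> N. s [^] Suc n = k \<otimes> a}"
      using inf not_finite_existsD by blast
    \<comment> \<open>The exponents must differ by at least 2: one factor \<open>s\<close> is
      cancelled by \<open>inv s\<close>, and the power \<open>s [^] Suc p\<close> that remains must
      still have a positive exponent to lie in \<open>S\<close>.\<close>
    moreover obtain m where m: "m > Suc n" "m \<in> {n::nat. \<exists>a \<in> N. s [^] Suc n = k \<otimes> a}"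
      using inf unfolding infinite_nat_iff_unbounded by blast
    ultimately obtain a b where a: "a \<in> N" "s [^] Suc n = k \<otimes> a"
      and b: "b \<in> N" "s [^] Suc m = k \<otimes> b" by auto
    obtain p where p: "m = Suc n + Suc p"
      using m(1) by (metis add_Suc_right less_imp_Suc_add)
    have c [simp]: "k \<in> carrier G" "a \<in> carrier G" "b \<in> carrier G"
      using k K(2) a(1) b(1) Nc by auto
    have "k \<otimes> b = s [^] (Suc n + Suc (Suc p))"
      using b(2) p by simp
    also have "\<dots> = s [^] Suc n \<otimes> s [^] Suc (Suc p)"
      by (rule nat_pow_mult[symmetric]) simp
    also have "\<dots> = k \<otimes> a \<otimes> (s \<otimes> s [^] Suc p)"
      using a(2) nat_pow_Suc2[OF sc, of "Suc p"] by metis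
    also have "\<dots> = k \<otimes> (a \<otimes> (s \<otimes> s [^] Suc p))"
      by (rule m_assoc) simp_all
    finally have "b = a \<otimes> (s \<otimes> s [^] Suc p)"
      by (simp del: nat_pow_Suc)
    then have "inv s \<otimes> (inv a \<otimes> b) = s [^] Suc p"
      by (simp add: m_assoc[symmetric] del: nat_pow_Suc)
    then show ?thesis using NU[OF a(1) b(1)] pow[of p] by metis
  qed
  then show ?thesis unfolding in_closure_of topspace_eq_carrier using sc by blast
qed

lemma subgroup_closure_of_precompact_subsemigroup:
  assumes S: "subsemigroup S G" and pre: "precompact_in G T S"
  shows "subgroup (T closure_of S) G"
proof (rule subgroupI)
  show "T closure_of S \<subseteq> carrier G"
    using closure_of_subset_topspace topspace_eq_carrier by metis
  have "S \<noteq> {}" "S \<subseteq> topspace T"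
    using S by (auto simp: subsemigroup_def topspace_eq_carrier)
  then show "T closure_of S \<noteq> {}"
    using closure_of_subset by blast
  have "(\<lambda>x. inv x) ` S \<subseteq> T closure_of S"
    using inv_in_closure_of_precompact_subsemigroup[OF S pre] by blast
  \<comment> \<open>By continuity, inverses of closure points lie in the closure of the set of
    inverses of \<open>S\<close>. That set is contained in the closed set
    \<open>T closure_of S\<close>, hence so is its closure.\<close>
  then have "(\<lambda>x. inv x) ` (T closure_of S) \<subseteq> T closure_of S"
    using continuous_map_image_closure_subset[OF continuous_inv, of S]
      closure_of_minimal[OF _ closedin_closure_of] by (metis subset_trans)
  then show "inv x \<in> T closure_of S" if "x \<in> T closure_of S" for x
    using that by blast
  show "x \<otimes> y \<in> T closure_of S" if "x \<in> T closure_of S" "y \<in> T closure_of S" for x y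
    using that S closure_of_mult_closed by (auto simp: subsemigroup_def)
qed

text \<open>With \<open>N <#> N \<subseteq> V\<close>, a finite \<open>K\<close> that works for
  \<open>S\<close> and \<open>N\<close> also works for the closure and \<open>V\<close>: closure
  points lie in \<open>S <#> N\<close> and in \<open>N <#> S\<close>, hence in
  \<open>K <#> N <#> N\<close> and in \<open>N <#> N <#> K\<close>.\<close>

lemma precompact_in_closure_of:
  assumes pre: "precompact_in G T S"
  shows "precompact_in G T (T closure_of S)"
  unfolding precompact_in_def
proof (intro conjI allI impI)
  show cl: "T closure_of S \<subseteq> carrier G"
    using closure_of_subset_topspace topspace_eq_carrier by metis
  fix V assume V: "neighbourhood_in T \<one> V"
  then obtain U where U: "openin T U" "\<one> \<in> U" "U \<subseteq> V"
    by (auto simp: neighbourhood_in_def)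
  obtain N where N: "openin T N" "\<one> \<in> N" and NU: "\<And>a b. a \<in> N \<Longrightarrow> b \<in> N \<Longrightarrow> a \<otimes> b \<in> U"
    using continuous_map_at_one_pair[OF continuous_mult U(1)] U(2) by auto
  have Nc: "N \<subseteq> carrier G" using N(1) openin_subset topspace_eq_carrier by blast
  have "neighbourhood_in T \<one> N"
    using N Nc by (auto simp: neighbourhood_in_def topspace_eq_carrier)
  with pre obtain K where K: "finite K" "K \<subseteq> carrier G" "S \<subseteq> K <#> N" "S \<subseteq> N <#> K"
    and Sc: "S \<subseteq> carrier G"
    unfolding precompact_in_def by blast
  \<comment> \<open>The preimage of \<open>N\<close> under \<open>f\<close> is an open neighbourhood
    of \<open>x\<close>, so it meets \<open>S\<close>. Taking for \<open>f\<close> the maps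
    \<open>inv y \<otimes> x\<close> and \<open>x \<otimes> inv y\<close> of \<open>y\<close>, both
    equal to \<open>\<one>\<close> at \<open>y = x\<close>, approximates \<open>x\<close> by
    elements of \<open>S\<close> up to a right or a left factor from \<open>N\<close>.\<close>
  have near: "\<exists>y \<in> S. f y \<in> N"
    if x: "x \<in> T closure_of S" and f: "continuous_map T T f" "f x = \<one>" for x f
  proof -
    have "openin T {y \<in> topspace T. f y \<in> N}"
      using openin_continuous_map_preimage[OF f(1) N(1)] .
    moreover have "x \<in> {y \<in> topspace T. f y \<in> N}"
      using x f(2) N(2) by (simp add: in_closure_of)
    ultimately obtain y where "y \<in> S" "y \<in> {y \<in> topspace T. f y \<in> N}"
      using x unfolding in_closure_of by meson
    then show ?thesis by blast
  qed
  have "x \<in> K <#> V \<and> x \<in> V <#> K" if x: "x \<in> T closure_of S" for x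
  proof
    have xc [simp]: "x \<in> carrier G" using x cl by auto
    have "continuous_map T T (\<lambda>y. inv y \<otimes> x)" "continuous_map T T (\<lambda>y. x \<otimes> inv y)"
      by (intro continuous_map_mult continuous_inv; simp add: topspace_eq_carrier)+
    then have "\<exists>y \<in> S. inv y \<otimes> x \<in> N" "\<exists>z \<in> S. x \<otimes> inv z \<in> N"
      using near[OF x] by simp_all
    then obtain y z where y: "y \<in> S" "inv y \<otimes> x \<in> N" and z: "z \<in> S" "x \<otimes> inv z \<in> N"
      by blast
    obtain k a where ka: "k \<in> K" "a \<in> N" "y = k \<otimes> a"
      using y(1) K(3) by (auto simp: set_mult_def)
    obtain l b where lb: "l \<in> K" "b \<in> N" "z = b \<otimes> l"
      using z(1) K(4) by (auto simp: set_mult_def)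
    have c [simp]: "k \<in> carrier G" "a \<in> carrier G" "l \<in> carrier G" "b \<in> carrier G"
        "y \<in> carrier G" "z \<in> carrier G"
      using ka lb K(2) Nc y z Sc by auto
    have "x = y \<otimes> (inv y \<otimes> x)" by (simp add: m_assoc[symmetric])
    \<comment> \<open>Both \<open>a\<close> and \<open>inv y \<otimes> x\<close> lie in
      \<open>N\<close>, so their product lies in \<open>U \<subseteq> V\<close>.\<close>
    also have "\<dots> = k \<otimes> (a \<otimes> (inv y \<otimes> x))" using ka(3) by (metis c m_assoc inv_closed m_closed xc)
    finally show "x \<in> K <#> V"
      using ka(1) NU[OF ka(2) y(2)] U(3) unfolding set_mult_def by blast
    have "x = (x \<otimes> inv z) \<otimes> z" by (simp add: m_assoc)
    also have "\<dots> = (x \<otimes> inv z \<otimes> b) \<otimes> l" using lb(3) by (metis c m_assoc inv_closed m_closed xc)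
    finally show "x \<in> V <#> K"
      using lb(1) NU[OF z(2) lb(2)] U(3) unfolding set_mult_def by blast
  qed
  then show "\<exists>K. finite K \<and> K \<subseteq> carrier G \<and> T closure_of S \<subseteq> K <#> V \<and> T closure_of S \<subseteq> V <#> K"
    using K(1,2) by blast
qed

end

theorem proposition2p4:
  fixes G :: "('a, 'b) monoid_scheme" and T :: "'a topology" and S :: "'a set"
  assumes "topological_group G T"
    and "Hausdorff_space T"
    and "subsemigroup S G"
    and "precompact_in G T S"
  shows "subgroup (T closure_of S) G \<and> precompact_in G T (T closure_of S)"
  using topological_group.subgroup_closure_of_precompact_subsemigroup[OF assms(1,3,4)]
    topological_group.precompact_in_closure_of[OF assms(1,4)] by blast

end
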